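(* Let $D$ be uniform and let $\alpha$ have a $\Delta^+$ representation. Suppose there exists $\varepsilon>0$ such that $C(\alpha)\cap[0,\varepsilon]$ is a self-similar set generated by similarities $f_j(x)=r_jx+b_j$ where $r_j>0$. Then $\alpha$ is translation equivalent to a rational number.
   Context: Let $n\ge 3$ be an integer and let $D=\{d_1<d_2<\cdots<d_m\}\subseteq\{0,1,\ldots,n-1\}$ be a digit set with $2\le m<n$ and $d_1=0$. $D$ is uniform if $d_{k+1}-d_k$, $k=1,\ldots,m-1$, is constant and $\ge2$. Put $C=C_{n,D}:=\{\sum_{k=1}^\infty x_k n^{-k} : x_k\in D \text{ for all } k\ge1\}$, $\Delta:=D-D$, $\Delta^+:=\Delta\cap[0,\infty)$. A real $\alpha$ has a $\Delta^+$ representation if $\alpha=\sum_{k\ge1}\alpha_kn^{-k}$ with all $\alpha_k\in\Delta^+$. For $t\in\mathbb{R}$, if $C\cap(C+t)\neq\varnothing$ let $C(t):=(C\cap(C+t))-\inf(C\cap(C+t))$, otherwise $C(t):=\varnothing$. Real numbers $s,t$ are translation equivalent if $C(s)=C(t)$. A self-similar set generated by finitely many contracting similarities $f_1,\ldots,f_\ell$ of $\mathbb{R}$ is the unique non-empty compact set $T$ with $T=\bigcup_j f_j(T)$. *)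

theory Defs
  imports "HOL-Analysis.Analysis"
begin

definition digit_set :: "nat \<Rightarrow> int set \<Rightarrow> bool" where
  "digit_set n D \<longleftrightarrow> D \<subseteq> {0..int n - 1} \<and> 2 \<le> card D \<and> card D < n \<and> Min D = 0"

(* The list index is 0-based: the entry at position k is the digit d_(k+1). *)
definition uniform :: "int set \<Rightarrow> bool" where
  "uniform D \<longleftrightarrow> (\<exists>d\<ge>2. \<forall>k. Suc k < card D \<longrightarrow>
     sorted_list_of_set D ! Suc k - sorted_list_of_set D ! k = d)"

(* Digit sequences are indexed from 0: x k is the coefficient of n^(-(k+1)).
   For n at least 2 and bounded digits the series converges absolutely. *)
definition radix_value :: "nat \<Rightarrow> (nat \<Rightarrow> int) \<Rightarrow> real" where
  "radix_value n x = (\<Sum>k. real_of_int (x k) / real n ^ Suc k)"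

definition cantor_set :: "nat \<Rightarrow> int set \<Rightarrow> real set" where
  "cantor_set n D = {radix_value n x |x. \<forall>k. x k \<in> D}"

definition digit_differences :: "int set \<Rightarrow> int set" where
  "digit_differences D = {a - b |a b. a \<in> D \<and> b \<in> D}"

definition nonneg_digit_differences :: "int set \<Rightarrow> int set" where
  "nonneg_digit_differences D = digit_differences D \<inter> {0..}"

definition has_nonneg_difference_representation :: "nat \<Rightarrow> int set \<Rightarrow> real \<Rightarrow> bool" where
  "has_nonneg_difference_representation n D \<alpha> \<longleftrightarrow>
     (\<exists>a. (\<forall>k. a k \<in> nonneg_digit_differences D) \<and> \<alpha> = radix_value n a)"

definition translate_intersection :: "nat \<Rightarrow> int set \<Rightarrow> real \<Rightarrow> real set" where
  "translate_intersection n D t = cantor_set n D \<inter> (\<lambda>x. x + t) ` cantor_set n D"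

definition normalized_intersection :: "nat \<Rightarrow> int set \<Rightarrow> real \<Rightarrow> real set" where
  "normalized_intersection n D t =
     (if translate_intersection n D t \<noteq> {}
      then (\<lambda>x. x - Inf (translate_intersection n D t)) ` translate_intersection n D t
      else {})"

definition translation_equivalent :: "nat \<Rightarrow> int set \<Rightarrow> real \<Rightarrow> real \<Rightarrow> bool" where
  "translation_equivalent n D s t \<longleftrightarrow>
     normalized_intersection n D s = normalized_intersection n D t"

definition contracting_similarity :: "(real \<Rightarrow> real) \<Rightarrow> bool" where
  "contracting_similarity f \<longleftrightarrow>
     (\<exists>r. 0 < r \<and> r < 1 \<and> (\<forall>x y. dist (f x) (f y) = r * dist x y))"

(* By Hutchinson's theorem at most one T satisfies this for a given F, so uniqueness is not
   part of the definition. F is nonempty because T is. *)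
definition self_similar_set_generated_by :: "(real \<Rightarrow> real) set \<Rightarrow> real set \<Rightarrow> bool" where
  "self_similar_set_generated_by F T \<longleftrightarrow>
     finite F \<and> (\<forall>f\<in>F. contracting_similarity f) \<and>
     T \<noteq> {} \<and> compact T \<and> T = (\<Union>f\<in>F. f ` T)"

end

theory Submission
  imports Defs
begin

text \<open>In fact \<open>\<alpha>\<close> itself is rational. Write \<open>D = {0, d, \<dots>, d M}\<close> and
  \<open>\<alpha> = \<Sum>k. d a\<^sub>k / n ^ (k + 1)\<close>. If \<open>\<alpha>\<close> has a second expansion over \<open>D - D\<close>, both end
  in extremal digits, so \<open>\<alpha>\<close> is rational. Otherwise \<open>C(\<alpha>) = d S\<close>, where \<open>S\<close> is the set of values
  of digit sequences \<open>z\<close> with \<open>0 \<le> z\<^sub>k \<le> b\<^sub>k := M - a\<^sub>k\<close>, and \<open>2 b\<^sub>k \<le> n - 1\<close>.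
  The similarity that fixes 0 gives \<open>r x \<in> S\<close> for all small \<open>x \<in> S\<close>. Choose \<open>p\<close> with
  \<open>n ^ (-p) \<le> r < n ^ (1 - p)\<close> and put \<open>u = r n ^ (p - 1)\<close>. Since elements of \<open>S\<close> below
  \<open>n ^ (-N)\<close> are at most half of it, scaling the points \<open>z / n ^ (k + 1)\<close> with \<open>z \<le> b\<^sub>k\<close>
  shows that either \<open>u = 1 / 2\<close>, and then \<open>b\<close> is eventually constant, or no multiple \<open>z u\<close>
  reaches 1, and then the digit of \<open>r b\<^sub>k / n ^ (k + 1)\<close> at position \<open>k + p\<close> is at least
  \<open>b\<^sub>k\<close>, so \<open>b\<^sub>k \<le> b\<^bsub>k + p\<^esub>\<close>. In both cases \<open>b\<close>, hence \<open>a\<close>, is eventually periodic.\<close>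

section \<open>Radix expansions: convergence, arithmetic, comparison, rationality\<close>

lemma radix_summable:
  assumes "n \<ge> 2" "\<And>k. \<bar>x k\<bar> \<le> B"
  shows "summable (\<lambda>k. real_of_int (x k) / real n ^ Suc k)"
proof (rule summable_comparison_test')
  have "summable (\<lambda>k. real_of_int B / real n * (1 / real n) ^ k)"
    using assms(1) by (intro summable_mult summable_geometric) auto
  then show "summable (\<lambda>k. real_of_int B / real n ^ Suc k)"
    by (simp add: power_one_over field_simps)
  fix k :: nat
  have "\<bar>real_of_int (x k)\<bar> \<le> real_of_int B"
    using assms(2)[of k] by linarith
  then show "norm (real_of_int (x k) / real n ^ Suc k) \<le> real_of_int B / real n ^ Suc k"
    by (simp add: divide_right_mono del: power_Suc)
qed

text \<open>Geometric series. It is the extremal series against which \<open>radix_le\<close> and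
  \<open>radix_maximal\<close> compare.\<close>

lemma radix_sums_const:
  assumes "n \<ge> 2"
  shows "(\<lambda>k. c * (real n - 1) / real n ^ Suc k) sums c"
proof -
  have "(\<lambda>k. c * (real n - 1) / real n * (1 / real n) ^ k)
        sums (c * (real n - 1) / real n * (1 / (1 - 1 / real n)))"
    using assms by (intro sums_mult geometric_sums) auto
  moreover have "c * (real n - 1) / real n * (1 / (1 - 1 / real n)) = c"
    using assms by (simp add: field_simps)
  ultimately show ?thesis
    by (simp add: power_one_over field_simps)
qed

lemma radix_add:
  assumes "n \<ge> 2" "\<And>k. \<bar>x k\<bar> \<le> A" "\<And>k. \<bar>y k\<bar> \<le> B"
  shows "radix_value n (\<lambda>k. x k + y k) = radix_value n x + radix_value n y"
  unfolding radix_value_def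
  by (subst suminf_add[OF radix_summable[OF assms(1,2)] radix_summable[OF assms(1,3)]])
     (simp add: add_divide_distrib)

lemma radix_mult:
  assumes "n \<ge> 2" "\<And>k. \<bar>x k\<bar> \<le> A"
  shows "radix_value n (\<lambda>k. c * x k) = of_int c * radix_value n x"
  unfolding radix_value_def
  by (subst suminf_mult[OF radix_summable[OF assms], symmetric]) simp

lemma radix_split:
  assumes "n \<ge> 2" "\<And>k. \<bar>x k\<bar> \<le> A"
  shows "radix_value n x =
    (\<Sum>k<N. of_int (x k) / real n ^ Suc k) + radix_value n (\<lambda>k. x (k + N)) / real n ^ N"
proof -
  have "radix_value n (\<lambda>k. x (k + N)) / real n ^ N
      = (\<Sum>k. of_int (x (k + N)) / real n ^ Suc (k + N))"
    unfolding radix_value_def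
    by (subst suminf_divide[OF radix_summable[OF assms(1), of "\<lambda>k. x (k + N)" A], symmetric])
       (use assms in \<open>auto simp: power_add field_simps\<close>)
  then show ?thesis
    using suminf_split_initial_segment[OF radix_summable[of n x A, OF assms], of N]
    by (simp add: radix_value_def)
qed

lemma radix_shift:
  assumes "n \<ge> 2" "\<And>k. \<bar>x k\<bar> \<le> A" "\<And>k. k < N \<Longrightarrow> x k = 0"
  shows "radix_value n (\<lambda>k. x (k + N)) = radix_value n x * real n ^ N"
  using radix_split[of n x A N, OF assms(1,2)] assms(1,3) by simp

lemma radix_step:
  assumes "n \<ge> 2" "\<And>k. \<bar>x k\<bar> \<le> A"
  shows "real n * radix_value n x = of_int (x 0) + radix_value n (\<lambda>k. x (Suc k))"
  using radix_split[of n x A 1, OF assms(1,2)] assms(1) by (simp add: field_simps)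

lemma radix_single:
  "radix_value n (\<lambda>j. if j = k then z else 0) = of_int z / real n ^ Suc k"
  unfolding radix_value_def
  by (subst suminf_finite[of "{k}"]) auto

lemma radix_nonneg:
  assumes "n \<ge> 2" "\<And>k. 0 \<le> x k" "\<And>k. x k \<le> A"
  shows "0 \<le> radix_value n x"
  unfolding radix_value_def
  by (rule suminf_nonneg[OF radix_summable[OF assms(1), of x A]]) (use assms in auto)

lemma digit_le_radix:
  assumes "n \<ge> 2" "\<And>k. 0 \<le> x k" "\<And>k. x k \<le> A"
  shows "of_int (x k) / real n ^ Suc k \<le> radix_value n x"
proof -
  have "summable (\<lambda>k. real_of_int (x k) / real n ^ Suc k)"
    by (rule radix_summable[OF assms(1), of x A]) (use assms in auto)
  from sum_le_suminf[OF this, of "{k}"] assms show ?thesis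
    by (simp add: radix_value_def)
qed

lemma radix_le:
  assumes "n \<ge> 2" "\<And>k. \<bar>x k\<bar> \<le> A" "\<And>k. of_int (x k) \<le> c * (real n - 1)"
  shows "radix_value n x \<le> c"
proof -
  have "radix_value n x \<le> (\<Sum>k. c * (real n - 1) / real n ^ Suc k)"
    unfolding radix_value_def
    using radix_summable[of n x A, OF assms(1,2)] sums_summable[OF radix_sums_const[OF assms(1)]]
    by (intro suminf_le) (auto intro!: divide_right_mono assms(3) simp del: power_Suc)
  then show ?thesis
    using sums_unique[OF radix_sums_const[OF assms(1)]] by metis
qed

text \<open>Equality case of \<open>radix_le\<close>: the termwise differences from the
  constant-digit series are nonnegative and sum to 0, so each of them vanishes.\<close>

lemma radix_maximal:
  assumes "n \<ge> 2" "\<And>k. \<bar>x k\<bar> \<le> A" "\<And>k. of_int (x k) \<le> c * (real n - 1)"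
    and "radix_value n x \<ge> c"
  shows "of_int (x k) = c * (real n - 1)"
proof -
  let ?g = "\<lambda>k. c * (real n - 1) / real n ^ Suc k - of_int (x k) / real n ^ Suc k"
  have eq: "radix_value n x = c"
    using radix_le[of n x A c, OF assms(1-3)] assms(4) by linarith
  have "(\<lambda>k. of_int (x k) / real n ^ Suc k) sums c"
    using summable_sums[OF radix_summable[of n x A, OF assms(1,2)]] eq
    by (simp add: radix_value_def del: power_Suc)
  from sums_diff[OF radix_sums_const[OF assms(1), of c] this] have s: "?g sums 0"
    by simp
  have nn: "0 \<le> ?g k" for k
    using assms(3)[of k] by (simp add: divide_right_mono del: power_Suc)
  have "\<forall>k. ?g k = 0"
    using suminf_eq_zero_iff[OF sums_summable[OF s] nn] sums_unique[OF s] by simp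
  then have "?g k = 0" by blast
  then have "(c * (real n - 1)) / real n ^ Suc k = of_int (x k) / real n ^ Suc k"
    by linarith
  then show ?thesis
    using assms(1) by (simp del: power_Suc)
qed

text \<open>The tail value \<open>v\<close> satisfies \<open>v = s + v / n ^ p\<close> with a
  rational finite sum \<open>s\<close>, and solving for \<open>v\<close> gives a rational.\<close>

lemma radix_eventually_periodic_rational:
  assumes "n \<ge> 2" "\<And>k. \<bar>x k\<bar> \<le> A" "p > 0" "\<And>k. k \<ge> N \<Longrightarrow> x (k + p) = x k"
  shows "radix_value n x \<in> \<rat>"
proof -
  let ?y = "\<lambda>k. x (k + N)"
  have y: "\<bar>?y k\<bar> \<le> A" for k
    using assms(2) .
  have "(\<lambda>k. ?y (k + p)) = ?y"
  proof
    fix k show "?y (k + p) = ?y k"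
      using assms(4)[of "k + N"] by (simp add: add_ac)
  qed
  then have "radix_value n ?y =
      (\<Sum>k<p. of_int (?y k) / real n ^ Suc k) + radix_value n ?y / real n ^ p"
    using radix_split[of n ?y A p, OF assms(1) y] by simp
  moreover have ne: "real n ^ p > 1"
    using assms(1,3) by (simp add: one_less_power)
  moreover have "v = s * P / (P - 1)" if "v = s + v / P" "P > 1" for v s P :: real
    using that by (simp add: field_simps)
  ultimately have "radix_value n ?y =
      (\<Sum>k<p. of_int (?y k) / real n ^ Suc k) * real n ^ p / (real n ^ p - 1)"
    by blast
  moreover have "\<dots> \<in> \<rat>"
    by (intro Rats_divide Rats_mult Rats_diff Rats_sum) auto
  ultimately have "radix_value n ?y \<in> \<rat>" by simp
  then show ?thesis
    by (subst radix_split[of n x A N, OF assms(1,2)])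
       (intro Rats_add Rats_sum Rats_divide; auto)
qed

section \<open>Digits at most half of \<open>n - 1\<close>\<close>

lemma half_digit_bound:
  assumes "2 * z \<le> int n - 1"
  shows "of_int z \<le> 1 / 2 * (real n - 1)"
proof -
  have "real_of_int (2 * z) \<le> real_of_int (int n - 1)"
    using assms by (simp only: of_int_le_iff)
  then show ?thesis by simp
qed

text \<open>Digits at most \<open>(n - 1) / 2\<close> leave gaps: no value lies strictly between
  half of a power of \<open>1 / n\<close> and that power.\<close>

lemma small_digits_leading_zeros:
  assumes "n \<ge> 2" "\<And>k. 0 \<le> z k" "\<And>k. z k \<le> A" "radix_value n z < 1 / real n ^ N" "k < N"
  shows "z k = 0"
proof -
  \<comment> \<open>A nonzero digit at a position \<open>k < N\<close> would alone contribute at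
    least \<open>1 / n ^ Suc k\<close>, which is at least \<open>1 / n ^ N\<close>.\<close>
  have "of_int (z k) / real n ^ Suc k < 1 / real n ^ N"
    using digit_le_radix[of n z A k, OF assms(1-3)] assms(4) by linarith
  also have "\<dots> \<le> 1 / real n ^ Suc k"
    using assms(1,5) by (intro divide_left_mono power_increasing) auto
  finally have "of_int (z k) < (1::real)"
    using assms(1) by (simp add: divide_less_cancel del: power_Suc)
  then show ?thesis using assms(2)[of k] by linarith
qed

text \<open>The first \<open>N\<close> digits vanish, so multiplying by \<open>n ^ N\<close> is a
  shift, and the shifted sequence still has value at most \<open>1 / 2\<close>.\<close>

lemma small_digits_gap:
  assumes "n \<ge> 2" "\<And>k. 0 \<le> z k" "\<And>k. 2 * z k \<le> int n - 1" "radix_value n z < 1 / real n ^ N"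
  shows "radix_value n z * real n ^ N \<le> 1 / 2"
proof -
  have A: "z k \<le> int n" "\<bar>z k\<bar> \<le> int n" for k
    using assms(2,3)[of k] by auto
  have "radix_value n (\<lambda>k. z (k + N)) \<le> 1 / 2"
  proof (rule radix_le[OF assms(1) A(2)])
    fix k show "of_int (z (k + N)) \<le> 1 / 2 * (real n - 1)"
      using assms(3) by (rule half_digit_bound)
  qed
  then show ?thesis
    using radix_shift[of n z "int n" N, OF assms(1) A(2)
        small_digits_leading_zeros[OF assms(1,2) A(1) assms(4)]] by simp
qed

section \<open>Periodicity forced by a scaling\<close>

text \<open>The sum over a window of length \<open>p\<close> changes by
  \<open>b (k + p) - b k\<close> when the window moves one place. From \<open>K\<close> on it is a
  nondecreasing bounded integer sequence, so it becomes constant and these increments become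
  0.\<close>

lemma monotone_shift_eventually_periodic:
  fixes b :: "nat \<Rightarrow> int"
  assumes "\<And>k. b k \<le> A" "\<And>k. k \<ge> K \<Longrightarrow> b k \<le> b (k + p)"
  shows "\<exists>N. \<forall>k\<ge>N. b (k + p) = b k"
proof -
  let ?s = "\<lambda>k. \<Sum>i<p. b (k + i)"
  have s_Suc: "?s (Suc k) = ?s k + (b (k + p) - b k)" for k
  proof -
    have "?s (Suc k) + b k = (\<Sum>i<Suc p. b (k + i))"
      by (subst sum.lessThan_Suc_shift) simp
    then show ?thesis by simp
  qed
  have mono: "?s k \<le> ?s l" if "K \<le> k" "k \<le> l" for k l
    using that(2)
  proof (induction l rule: dec_induct)
    case (step l)
    then show ?case
      using that(1) assms(2)[of l] s_Suc[of l] by linarith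
  qed simp
  have bound: "?s k \<le> int p * A" for k
    using sum_bounded_above[of "{..<p}" "\<lambda>i. b (k + i)" A] assms(1) by simp
  \<comment> \<open>Subtracting the value at \<open>K\<close> makes the window sums nonnegative from
    \<open>K\<close> on, so \<open>nat\<close> loses nothing and a greatest natural number can be
    taken.\<close>
  let ?P = "\<lambda>v. \<exists>k\<ge>K. v = nat (?s k - ?s K)"
  have "\<exists>v. ?P v \<and> (\<forall>w. ?P w \<longrightarrow> w \<le> v)"
  proof (rule ex_has_greatest_nat[of ?P _ "\<lambda>v. v" "Suc (nat (int p * A - ?s K))"])
    show "?P (nat (?s K - ?s K))" by blast
    have "nat (?s k - ?s K) < Suc (nat (int p * A - ?s K))" for k
      unfolding less_Suc_eq_le by (rule nat_mono) (rule diff_right_mono[OF bound])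
    then show "\<forall>w. ?P w \<longrightarrow> w < Suc (nat (int p * A - ?s K))"
      by blast
  qed
  then obtain N where N: "N \<ge> K" "\<And>k. k \<ge> K \<Longrightarrow> nat (?s k - ?s K) \<le> nat (?s N - ?s K)"
    by blast
  have const: "?s k = ?s N" if "k \<ge> N" for k
    using N(2)[of k] mono[of K k] mono[of K N] mono[of N k] N(1) that by linarith
  have "b (k + p) = b k" if "k \<ge> N" for k
    using const[of k] const[of "Suc k"] s_Suc[of k] that by simp
  then show ?thesis by blast
qed

text \<open>The scaling is assumed only up to \<open>\<epsilon>\<close> because self-similarity is
  known only near 0. This suffices: the argument tests it on points with a single nonzero digit far
  out in the expansion.\<close>

lemma scaling_eventually_periodic:
  fixes n :: nat and b :: "nat \<Rightarrow> int"
  defines "S \<equiv> {radix_value n z |z. \<forall>k. 0 \<le> z k \<and> z k \<le> b k}"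
  assumes n: "n \<ge> 2" and b: "\<And>k. 0 \<le> b k" "\<And>k. 2 * b k \<le> int n - 1"
    and r: "0 < r" "r < 1" and \<epsilon>: "\<epsilon> > 0"
    and scal: "\<And>x. x \<in> S \<Longrightarrow> x \<le> \<epsilon> \<Longrightarrow> r * x \<in> S"
  shows "\<exists>p>0. \<exists>N. \<forall>k\<ge>N. b (k + p) = b k"
proof -
  have small: "\<exists>k. 1 / real n ^ k < e" if "e > 0" for e
    using real_arch_pow_inv[OF that, of "1 / real n"] n by (auto simp: power_one_over)
  \<comment> \<open>Minimality places \<open>r\<close> between two consecutive powers:
    \<open>1 / n ^ p \<le> r < 1 / n ^ q\<close> with \<open>p = Suc q\<close>.\<close>
  define p where "p = (LEAST p. 1 / real n ^ p \<le> r)"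
  have p: "1 / real n ^ p \<le> r"
    unfolding p_def using small[OF r(1)] by (metis (lifting) LeastI_ex less_imp_le)
  have "p \<noteq> 0"
    using p r(2) by (intro notI) simp
  then obtain q where q: "p = Suc q"
    using not0_implies_Suc by blast
  have "\<not> 1 / real n ^ q \<le> r"
    using not_less_Least[of q "\<lambda>p. 1 / real n ^ p \<le> r"] q by (simp add: p_def)
  \<comment> \<open>Scaling by \<open>r\<close> is thus a shift by \<open>q\<close> places followed
    by multiplication by \<open>u\<close>, where \<open>1 / n \<le> u < 1\<close>.\<close>
  define u where "u = r * real n ^ q"
  have u: "0 < u" "u < 1" "1 \<le> real n * u"
    using n r(1) p \<open>\<not> 1 / real n ^ q \<le> r\<close> by (auto simp: u_def q field_simps)
  obtain K where K: "1 / real n ^ K < \<epsilon>"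
    using small[OF \<epsilon>] by blast
  \<comment> \<open>Here \<open>w\<close> expands the image of the point with the single digit
    \<open>z\<close> at position \<open>k\<close>; \<open>k \<ge> K\<close> keeps that point below
    \<open>\<epsilon>\<close>. The exponent is \<open>Suc k + q = k + p\<close>.\<close>
  have scaled: "\<exists>w. (\<forall>j. 0 \<le> w j \<and> w j \<le> b j) \<and>
      radix_value n w = of_int z * u / real n ^ (k + p)"
    if "k \<ge> K" "0 \<le> z" "z \<le> b k" for k z
  proof -
    have "of_int z / real n ^ Suc k \<in> S"
      unfolding S_def using radix_single[of n k z, symmetric] that b by fastforce
    moreover have "of_int z / real n ^ Suc k \<le> \<epsilon>"
    proof -
      have "of_int z \<le> real n"
        using that(3) b(1)[of k] b(2)[of k] by linarith
      then have "of_int z / real n ^ Suc k \<le> real n / real n ^ Suc k"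
        by (intro divide_right_mono) auto
      also have "\<dots> = 1 / real n ^ k"
        using n by simp
      also have "\<dots> \<le> 1 / real n ^ K"
        using n that(1) by (intro divide_left_mono power_increasing) auto
      finally show ?thesis using K by linarith
    qed
    ultimately have "r * (of_int z / real n ^ Suc k) \<in> S"
      by (rule scal)
    moreover have "r * (of_int z / real n ^ Suc k) = of_int z * u / real n ^ (k + p)"
      using n by (simp add: u_def q power_add field_simps)
    ultimately show ?thesis
      unfolding S_def by (smt (verit) mem_Collect_eq)
  qed
  have digits: "0 \<le> w j" "2 * w j \<le> int n - 1" "w j \<le> int n" "\<bar>w j\<bar> \<le> int n"
    if "\<forall>j. 0 \<le> w j \<and> w j \<le> b j" for w j
    using that[rule_format, of j] b(2)[of j] by linarith+
  have gap: "of_int z * u \<le> 1 / 2"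
    if k: "k \<ge> K" "0 \<le> z" "z \<le> b k" and zu: "of_int z * u < 1" for k z
  proof -
    obtain w where w: "\<forall>j. 0 \<le> w j \<and> w j \<le> b j"
      "radix_value n w = of_int z * u / real n ^ (k + p)"
      using scaled[OF k] by blast
    have "radix_value n w < 1 / real n ^ (k + p)"
      using zu n by (simp add: w(2) divide_strict_right_mono)
    from small_digits_gap[of n w, OF n digits(1,2)[OF w(1)] this] show ?thesis
      using n by (simp add: w(2))
  qed
  have tail: "\<exists>w. (\<forall>j. 0 \<le> w j \<and> w j \<le> b (j + (k + p))) \<and> radix_value n w = of_int z * u"
    if k: "k \<ge> K" "0 \<le> z" "z \<le> b k" and zu: "of_int z * u < 1" for k z
  proof -
    obtain w where w: "\<forall>j. 0 \<le> w j \<and> w j \<le> b j"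
      "radix_value n w = of_int z * u / real n ^ (k + p)"
      using scaled[OF k] by blast
    have "radix_value n w < 1 / real n ^ (k + p)"
      using zu n by (simp add: w(2) divide_strict_right_mono)
    from radix_shift[of n w "int n" "k + p", OF n digits(4)[OF w(1)]
        small_digits_leading_zeros[OF n digits(1,3)[OF w(1)] this]] n
    have "radix_value n (\<lambda>j. w (j + (k + p))) = of_int z * u"
      by (simp add: w(2))
    then show ?thesis using w(1) by (intro exI[of _ "\<lambda>j. w (j + (k + p))"]) auto
  qed
  show ?thesis
  \<comment> \<open>Only at \<open>u = 1 / 2\<close> can two quantities of the form
    \<open>z * u\<close> bounded by \<open>1 / 2\<close> add up to 1 with one of them equal to
    \<open>u\<close>.\<close>
  proof (cases "u = 1 / 2")
    case True
    show ?thesis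
    proof (cases "\<exists>k\<ge>K. b k \<ge> 1")
      case True
      then obtain k where k: "k \<ge> K" "b k \<ge> 1" by blast
      obtain w where w: "\<forall>j. 0 \<le> w j \<and> w j \<le> b (j + (k + p))" "radix_value n w = u"
        using tail[of k 1] k u by auto
      \<comment> \<open>The scaled digit 1 has tail value \<open>1 / 2\<close>, the largest that
        digits up to \<open>(n - 1) / 2\<close> can reach. All digits of \<open>w\<close>, and with
        them the bounds \<open>b j\<close>, are therefore maximal.\<close>
      have "of_int (b j) = (1 / 2) * (real n - 1)" if "j \<ge> k + p" for j
      proof -
        have w': "\<bar>w i\<bar> \<le> int n" "of_int (w i) \<le> (1 / 2) * (real n - 1)" for i
          using w(1)[rule_format, of i] b(2)[of "i + (k + p)"]
            half_digit_bound[of "w i" n] by linarith+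
        have "of_int (w (j - (k + p))) = (1 / 2) * (real n - 1)"
          by (rule radix_maximal[OF n w']) (use w(2) \<open>u = 1 / 2\<close> in simp)
        moreover have "w (j - (k + p)) \<le> b j"
          using w(1)[rule_format, of "j - (k + p)"] that by simp
        ultimately show ?thesis using half_digit_bound[OF b(2)[of j]] by linarith
      qed
      then have "\<forall>j\<ge>k + p. b (j + 1) = b j"
        by (metis (no_types, opaque_lifting) of_int_eq_iff le_add1 order_trans)
      then show ?thesis using zero_less_one by blast
    next
      case False
      have "b k = 0" if "k \<ge> K" for k
      proof -
        have "\<not> b k \<ge> 1" using False that by blast
        then show ?thesis using b(1)[of k] by linarith
      qed
      then have "\<forall>k\<ge>K. b (k + 1) = b k" by simp
      then show ?thesis using zero_less_one by blast
    qed
  next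
    case False
    \<comment> \<open>Both \<open>z * u\<close> and \<open>u\<close> are at most
      \<open>1 / 2\<close> by \<open>gap\<close>, so their sum is at most 1, with equality only if
      \<open>u = 1 / 2\<close>.\<close>
    have no_carry: "of_int (int z) * u < 1" if "k \<ge> K" "int z \<le> b k" for k z
      using that(2)
    proof (induction z)
      case (Suc z)
      have "of_int 1 * u \<le> 1 / 2"
        using gap[of k 1] that(1) Suc.prems u by simp
      moreover have "of_int (int z) * u \<le> 1 / 2"
        using Suc that(1) by (intro gap[of k]) auto
      ultimately show ?case
        using False by (simp add: algebra_simps)
    qed simp
    have "b k \<le> b (k + p)" if "k \<ge> K" for k
    proof -
      have "of_int (b k) * u < 1"
        using no_carry[of k "nat (b k)"] that b(1)[of k] by simp
      then obtain w where w: "\<forall>j. 0 \<le> w j \<and> w j \<le> b (j + (k + p))"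
        "radix_value n w = of_int (b k) * u"
        using tail[OF \<open>K \<le> k\<close> b(1) order_refl] by blast
      have w': "\<bar>w i\<bar> \<le> int n" "of_int (w i) \<le> (1 / 2) * (real n - 1)" for i
        using w(1)[rule_format, of i] b(2)[of "i + (k + p)"]
            half_digit_bound[of "w i" n] by linarith+
      \<comment> \<open>Since \<open>n * u \<ge> 1\<close> and the remainder is at most
        \<open>1 / 2\<close>, \<open>b k \<le> w 0 + 1 / 2\<close>; integrality removes the
        half.\<close>
      have "real n * (of_int (b k) * u) = of_int (w 0) + radix_value n (\<lambda>i. w (Suc i))"
        using radix_step[of n w, OF n w'(1)] w(2) by simp
      moreover have "radix_value n (\<lambda>i. w (Suc i)) \<le> 1 / 2"
        by (rule radix_le[OF n w'])
      moreover have "of_int (b k) * 1 \<le> of_int (b k) * (real n * u)"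
        using u(3) b(1) by (intro mult_left_mono) auto
      ultimately have "b k \<le> w 0"
        by (simp add: mult_ac)
      then show ?thesis using w(1)[rule_format, of 0] by simp
    qed
    moreover have "b k \<le> int n" for k
      using b[of k] by linarith
    ultimately have "\<exists>N. \<forall>k\<ge>N. b (k + p) = b k"
      by (rule monotone_shift_eventually_periodic[rotated])
    then show ?thesis using q by blast
  qed
qed

section \<open>Uniform digit sets and uniqueness of difference expansions\<close>

text \<open>The sorted digits form an arithmetic progression starting at \<open>Min D = 0\<close>.
  Its last term \<open>d * M\<close> is itself a digit, which bounds it by
  \<open>n - 1\<close>.\<close>

lemma uniform_digits:
  assumes "digit_set n D" "uniform D"
  shows "\<exists>d M. d \<ge> 2 \<and> d * M \<le> int n - 1 \<and> D = (\<lambda>i. d * i) ` {0..M}"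
proof -
  have D: "D \<subseteq> {0..int n - 1}" "2 \<le> card D" "Min D = 0"
    using assms(1) by (auto simp: digit_set_def)
  have fin: "finite D" using D(1) finite_subset by blast
  let ?l = "sorted_list_of_set D"
  obtain d where d: "d \<ge> 2" "\<And>k. Suc k < card D \<Longrightarrow> ?l ! Suc k - ?l ! k = d"
    using assms(2) by (auto simp: uniform_def)
  have l: "set ?l = D" "length ?l = card D"
    using fin by auto
  have "?l ! 0 = 0"
    using sorted_list_of_set_nonempty[of D] fin D(2,3) by (cases "D = {}") auto
  then have nth: "k < card D \<Longrightarrow> ?l ! k = d * int k" for k
  proof (induction k)
    case (Suc k)
    then show ?case using d(2)[of k] by (simp add: algebra_simps)
  qed simp
  have "D = (\<lambda>k. d * int k) ` {..<card D}"
    using nth l unfolding set_conv_nth l(2)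
    by (auto 4 4 simp: l simp flip: nth)
  also have "\<dots> = (\<lambda>i. d * i) ` int ` {..<card D}"
    by (simp add: image_image)
  also have "int ` {..<card D} = {0..int (card D) - 1}"
    by (force simp: image_iff intro: bexI[of _ "nat _"])
  finally have eq: "D = (\<lambda>i. d * i) ` {0..int (card D) - 1}" .
  moreover have "d * (int (card D) - 1) \<in> D"
    using D(2) by (subst eq) auto
  ultimately show ?thesis using d(1) D(1) by fastforce
qed

text \<open>Two distinct difference representations can agree in value only if \<open>d = 2\<close> and
  their remainders are extremal with opposite signs.\<close>

lemma nonunique_difference_representation_rational:
  fixes a x :: "nat \<Rightarrow> int"
  assumes n: "n \<ge> 2" and d: "d \<ge> 2" "d * M \<le> int n - 1"
    and a: "\<And>k. \<bar>a k\<bar> \<le> M" and x: "\<And>k. \<bar>x k\<bar> \<le> M"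
    and eq: "radix_value n (\<lambda>k. d * a k) = radix_value n (\<lambda>k. d * x k)"
    and ne: "a j \<noteq> x j"
  shows "radix_value n (\<lambda>k. d * a k) \<in> \<rat>"
proof -
  have bound: "\<bar>d * y k\<bar> \<le> int n - 1" if "\<And>k. \<bar>y k\<bar> \<le> M" for y :: "nat \<Rightarrow> int" and k
  proof -
    have "d * \<bar>y k\<bar> \<le> d * M"
      using that d(1) by (intro mult_left_mono) auto
    also have "d * \<bar>y k\<bar> = \<bar>d * y k\<bar>"
      using d(1) by (simp add: abs_mult)
    finally show ?thesis using d(2) by linarith
  qed
  define N where "N = (LEAST j. a j \<noteq> x j)"
  have N: "a N \<noteq> x N"
    unfolding N_def using ne by (rule LeastI)
  have lt: "k < N \<Longrightarrow> a k = x k" for k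
    unfolding N_def using not_less_Least by blast
  \<comment> \<open>Stated for generic \<open>y\<close> and \<open>z\<close> so that either sequence
    may have the smaller digit at \<open>N\<close>.\<close>
  have final: "radix_value n (\<lambda>k. d * y k) \<in> \<rat>"
    if y: "\<And>k. \<bar>y k\<bar> \<le> M" and z: "\<And>k. \<bar>z k\<bar> \<le> M"
      and eq: "radix_value n (\<lambda>k. d * y k) = radix_value n (\<lambda>k. d * z k)"
      and N: "y N < z N" and lt: "\<And>k. k < N \<Longrightarrow> y k = z k" for y z :: "nat \<Rightarrow> int"
  proof -
    note by' = bound[of y, OF y] and bz = bound[of z, OF z]
    let ?y = "\<lambda>k. d * y (k + Suc N)" and ?z = "\<lambda>k. - (d * z (k + Suc N))"
    \<comment> \<open>The difference of the tails after \<open>N\<close>; its value must balance the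
      difference \<open>d * (z N - y N)\<close> at \<open>N\<close>, which is at least 2.\<close>
    let ?e = "\<lambda>k. ?y k + ?z k"
    have "(\<Sum>k<Suc N. of_int (d * y k) / real n ^ Suc k) + radix_value n ?y / real n ^ Suc N
        = (\<Sum>k<Suc N. of_int (d * z k) / real n ^ Suc k)
          + radix_value n (\<lambda>k. d * z (k + Suc N)) / real n ^ Suc N"
      using radix_split[of n "\<lambda>k. d * y k" _ "Suc N", OF n by']
        radix_split[of n "\<lambda>k. d * z k" _ "Suc N", OF n bz] eq by simp
    then have "(of_int (d * y N) + radix_value n ?y) / real n ^ Suc N
        = (of_int (d * z N) + radix_value n (\<lambda>k. d * z (k + Suc N))) / real n ^ Suc N"
      using lt by (simp add: add_divide_distrib del: power_Suc of_int_mult)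
    then have "of_int (d * y N) + radix_value n ?y
        = of_int (d * z N) + radix_value n (\<lambda>k. d * z (k + Suc N))"
      using n by (simp del: power_Suc of_int_mult)
    moreover have "radix_value n ?e = radix_value n ?y - radix_value n (\<lambda>k. d * z (k + Suc N))"
      using radix_add[of n ?y "int n - 1" ?z "int n - 1"] n by' bz
        radix_mult[of n "\<lambda>k. d * z (k + Suc N)" "int n - 1" "-1"] by simp
    ultimately have "radix_value n ?e = of_int (d * (z N - y N))"
      by (simp add: algebra_simps)
    moreover have "d * 1 \<le> d * (z N - y N)"
      using d(1) N by (intro mult_left_mono) auto
    ultimately have ge: "radix_value n ?e \<ge> 2"
      using d(1) by linarith
    have e': "?e k \<le> 2 * (int n - 1)" and e: "\<bar>?e k\<bar> \<le> 2 * int n" for k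
      using by'[of "k + Suc N"] bz[of "k + Suc N"] by (smt (verit))+
    have top: "of_int (2 * (int n - 1)) = 2 * (real n - 1)" by simp
    have er: "of_int (?e k) \<le> 2 * (real n - 1)" for k
      using e'[of k] unfolding top[symmetric] of_int_le_iff .
    \<comment> \<open>Digits up to \<open>2 * (n - 1)\<close> give a value of at most 2, so this is
      the equality case, and both summands of \<open>?e k\<close> are then
      \<open>n - 1\<close>.\<close>
    have "?e k = 2 * (int n - 1)" for k
      using radix_maximal[of n ?e "2 * int n" 2 k, OF n e er ge]
      unfolding top[symmetric] of_int_eq_iff .
    then have "?y k = int n - 1" for k
      using by'[of "k + Suc N"] bz[of "k + Suc N"] by (smt (verit))
    then have "d * y k = int n - 1" if "k \<ge> Suc N" for k
      using that by (metis le_add_diff_inverse2)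
    then show ?thesis
      by (intro radix_eventually_periodic_rational[OF n by', of 1 "Suc N"]) auto
  qed
  show ?thesis
  proof (cases "a N < x N")
    case True
    then show ?thesis using final[OF a x eq] lt by blast
  next
    case False
    then show ?thesis using final[OF x a eq[symmetric]] N lt eq by fastforce
  qed
qed

section \<open>Structure of C(\<alpha>) and its scaling at 0\<close>

text \<open>A point of the intersection has digits \<open>x\<close> in one copy and \<open>y\<close>
  in the other, and \<open>x - y\<close> is a signed expansion of \<alpha>. Uniqueness makes it
  \<open>a\<close>, which turns membership into the separate conditions
  \<open>0 \<le> y k \<le> M - a k\<close>.\<close>

lemma normalized_intersection_unique:
  fixes a :: "nat \<Rightarrow> int"
  assumes n: "n \<ge> 2" and d: "d > 0" and D: "D = (\<lambda>i. d * i) ` {0..M}"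
    and a: "\<And>k. 0 \<le> a k" "\<And>k. a k \<le> M"
    and \<alpha>: "\<alpha> = radix_value n (\<lambda>k. d * a k)"
    and unique: "\<And>x. (\<And>k. \<bar>x k\<bar> \<le> M) \<Longrightarrow> radix_value n (\<lambda>k. d * x k) = \<alpha> \<Longrightarrow> x = a"
  shows "normalized_intersection n D \<alpha> =
    {of_int d * radix_value n z |z. \<forall>k. 0 \<le> z k \<and> z k \<le> M - a k}" (is "_ = ?S")
proof -
  have val: "radix_value n (\<lambda>k. d * x k) = of_int d * radix_value n x"
    if "\<And>k. \<bar>x k\<bar> \<le> M" for x
    using radix_mult[of n x M, OF n that] .
  have C: "cantor_set n D = {of_int d * radix_value n x |x. \<forall>k. 0 \<le> x k \<and> x k \<le> M}" (is "_ = ?C")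
  proof
    show "cantor_set n D \<subseteq> ?C"
    proof
      fix v assume "v \<in> cantor_set n D"
      then obtain y where y: "v = radix_value n y" "\<And>k. y k \<in> D"
        by (auto simp: cantor_set_def)
      then have "\<forall>k. \<exists>i. y k = d * i \<and> 0 \<le> i \<and> i \<le> M"
        unfolding D by fastforce
      then obtain x where x: "\<And>k. y k = d * x k \<and> 0 \<le> x k \<and> x k \<le> M"
        by metis
      then have "y = (\<lambda>k. d * x k)" by auto
      then show "v \<in> ?C" using x y(1) val[of x] by auto
    qed
    show "?C \<subseteq> cantor_set n D"
    proof
      fix v assume "v \<in> ?C"
      then obtain x where x: "v = of_int d * radix_value n x" "\<forall>k. 0 \<le> x k \<and> x k \<le> M"
        by blast
      then have "v = radix_value n (\<lambda>k. d * x k)" using val[of x] by simp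
      moreover have "\<forall>k. d * x k \<in> D" using x(2) by (auto simp: D)
      ultimately show "v \<in> cantor_set n D" unfolding cantor_set_def by blast
    qed
  qed
  have \<alpha>': "\<alpha> = of_int d * radix_value n a"
    using \<alpha> val[of a] a by simp
  have T: "translate_intersection n D \<alpha> = (\<lambda>v. v + \<alpha>) ` ?S"
  proof
    show "translate_intersection n D \<alpha> \<subseteq> (\<lambda>v. v + \<alpha>) ` ?S"
    proof
      fix v assume "v \<in> translate_intersection n D \<alpha>"
      then obtain x y where x: "v = of_int d * radix_value n x" "\<forall>k. 0 \<le> x k \<and> x k \<le> M"
        and y: "v = of_int d * radix_value n y + \<alpha>" "\<forall>k. 0 \<le> y k \<and> y k \<le> M"
        unfolding translate_intersection_def C by blast
      have xy: "\<bar>x k\<bar> \<le> M" "\<bar>- y k\<bar> \<le> M" "\<bar>x k + - y k\<bar> \<le> M" for k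
        using x(2)[rule_format, of k] y(2)[rule_format, of k] by linarith+
      have "radix_value n (\<lambda>k. d * (x k + - y k)) = of_int d * radix_value n (\<lambda>k. x k + - y k)"
        by (rule val) (rule xy)
      also have "\<dots> = of_int d * (radix_value n x - radix_value n y)"
        using radix_add[of n x M "\<lambda>k. - y k" M] radix_mult[of n y M "-1"] n xy by simp
      also have "\<dots> = \<alpha>"
        using x(1) y(1) by (simp add: algebra_simps)
      finally have "(\<lambda>k. x k + - y k) = a"
        by (intro unique xy)
      then have "\<forall>k. 0 \<le> y k \<and> y k \<le> M - a k"
        using x(2) y(2) by fastforce
      then show "v \<in> (\<lambda>v. v + \<alpha>) ` ?S" using y(1) by blast
    qed
    show "(\<lambda>v. v + \<alpha>) ` ?S \<subseteq> translate_intersection n D \<alpha>"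
    proof
      fix v assume "v \<in> (\<lambda>v. v + \<alpha>) ` ?S"
      then obtain z where z: "v = of_int d * radix_value n z + \<alpha>" "\<forall>k. 0 \<le> z k \<and> z k \<le> M - a k"
        by blast
      have z': "0 \<le> z k" "z k \<le> M" "\<bar>z k\<bar> \<le> M" "\<bar>a k\<bar> \<le> M" "0 \<le> z k + a k" "z k + a k \<le> M" for k
        using z(2)[rule_format, of k] a(1,2)[of k] by linarith+
      have "v = of_int d * radix_value n (\<lambda>k. z k + a k)"
        using radix_add[of n z M a M, OF n z'(3,4)] z(1) \<alpha>' by (simp add: algebra_simps)
      then have "v \<in> ?C"
        using z'(5,6) by (intro CollectI exI[of _ "\<lambda>k. z k + a k"] conjI allI)
      moreover have "of_int d * radix_value n z \<in> ?C"
        using z'(1,2) by (intro CollectI exI[of _ z] conjI allI refl)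
      ultimately show "v \<in> translate_intersection n D \<alpha>"
        unfolding translate_intersection_def C using z(1) by (intro IntI image_eqI)
    qed
  qed
  have "radix_value n (\<lambda>_. 0) = 0" by (simp add: radix_value_def)
  then have zero: "0 \<in> ?S" using a(2) by (intro CollectI exI[of _ "\<lambda>_. 0"]) auto
  have nonneg: "0 \<le> v" if v: "v \<in> ?S" for v
  proof -
    from v obtain z where z: "v = of_int d * radix_value n z" "\<forall>k. 0 \<le> z k \<and> z k \<le> M - a k"
      by blast
    have "0 \<le> radix_value n z"
    proof (rule radix_nonneg[OF n])
      fix k show "0 \<le> z k" "z k \<le> M"
        using z(2)[rule_format, of k] a(1)[of k] by linarith+
    qed
    then show ?thesis using z(1) d by simp
  qed
  \<comment> \<open>The zero sequence gives the minimum, so normalizing exactly undoes the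
    translation by \<alpha>.\<close>
  have min: "\<alpha> \<in> (\<lambda>v. v + \<alpha>) ` ?S"
    using zero by (rule rev_image_eqI) simp
  have "Inf ((\<lambda>v. v + \<alpha>) ` ?S) = \<alpha>"
  proof (rule cInf_eq_minimum[OF min])
    fix v assume "v \<in> (\<lambda>v. v + \<alpha>) ` ?S"
    then obtain t where "v = t + \<alpha>" "t \<in> ?S" by (rule imageE)
    then show "\<alpha> \<le> v" using nonneg[of t] by linarith
  qed
  moreover have "(\<lambda>v. v + \<alpha>) ` ?S \<noteq> {}" using min by (rule ex_in_conv[THEN iffD1, OF exI])
  ultimately show ?thesis
    unfolding normalized_intersection_def T
    by (simp only: image_image add_diff_cancel_right' image_ident if_True not_False_eq_True)
qed

text \<open>The similarity whose image contains the minimum 0 must fix it.\<close>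

lemma self_similar_scaling_factor:
  assumes F: "\<forall>f\<in>F. \<exists>r b. r > 0 \<and> f = (\<lambda>x. r * x + b)"
    and T: "self_similar_set_generated_by F T" "0 \<in> T" "\<And>x. x \<in> T \<Longrightarrow> 0 \<le> x"
  shows "\<exists>r>0. r < 1 \<and> (\<forall>x\<in>T. r * x \<in> T)"
proof -
  have T': "T = (\<Union>f\<in>F. f ` T)" and c: "\<forall>f\<in>F. contracting_similarity f"
    using T(1) by (auto simp: self_similar_set_generated_by_def)
  have "0 \<in> (\<Union>f\<in>F. f ` T)"
    by (rule subsetD[OF equalityD1[OF T'] T(2)])
  then obtain f x where f: "f \<in> F" "x \<in> T" "f x = 0"
    by force
  obtain r b where r: "r > 0" "f = (\<lambda>x. r * x + b)"
    using F f(1) by blast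
  have maps: "f y \<in> T" if "y \<in> T" for y
    by (rule subsetD[OF equalityD2[OF T']]) (use f(1) that in blast)
  \<comment> \<open>\<open>b\<close> is the image of 0 and hence in \<open>T\<close>, so
    \<open>r * x + b = 0\<close> is a sum of two nonnegative terms.\<close>
  have "0 \<le> b" using T(3)[OF maps[OF T(2)]] r(2) by simp
  moreover have "0 \<le> r * x" using r(1) T(3)[OF f(2)] by simp
  ultimately have "b = 0" using f(3) r(2) by simp
  \<comment> \<open>The bound \<open>r < 1\<close> comes from the contraction ratio, identified with
    \<open>r\<close> on the points 0 and 1.\<close>
  obtain s where s: "s < 1" "\<And>x y. dist (f x) (f y) = s * dist x y"
    using c f(1) by (auto simp: contracting_similarity_def)
  have "r = s" using s(2)[of 1 0] r by (simp add: dist_real_def)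
  then show ?thesis using r s(1) maps \<open>b = 0\<close> by auto
qed

section \<open>Rationality of \<alpha>\<close>

theorem theorem6p3:
  fixes n :: nat and D :: "int set" and \<alpha> :: real
  assumes "n \<ge> 3"
    and "digit_set n D"
    and "uniform D"
    and "has_nonneg_difference_representation n D \<alpha>"
    and "\<exists>\<epsilon>>0. \<exists>F. (\<forall>f\<in>F. \<exists>r b. r > 0 \<and> f = (\<lambda>x. r * x + b)) \<and>
           self_similar_set_generated_by F (normalized_intersection n D \<alpha> \<inter> {0..\<epsilon>})"
  shows "\<exists>q\<in>\<rat>. translation_equivalent n D \<alpha> q"
proof -
  have n: "n \<ge> 2" using assms(1) by simp
  obtain d M where d: "d \<ge> 2" "d * M \<le> int n - 1" and D: "D = (\<lambda>i. d * i) ` {0..M}"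
    using uniform_digits[OF assms(2,3)] by blast
  obtain a' where a': "\<And>k. a' k \<in> nonneg_digit_differences D" "\<alpha> = radix_value n a'"
    using assms(4) by (auto simp: has_nonneg_difference_representation_def)
  have "\<forall>k. \<exists>i. a' k = d * i \<and> 0 \<le> i \<and> i \<le> M"
  proof
    fix k
    obtain i j where ij: "a' k = d * i - d * j" "0 \<le> i" "i \<le> M" "0 \<le> j" "j \<le> M" "0 \<le> a' k"
      using a'(1)[of k] unfolding nonneg_digit_differences_def digit_differences_def D by auto
    then have "0 \<le> d * (i - j)" by (simp add: algebra_simps)
    then have "0 \<le> i - j" using d(1) by (simp add: zero_le_mult_iff)
    then show "\<exists>i. a' k = d * i \<and> 0 \<le> i \<and> i \<le> M"
      using ij by (intro exI[of _ "i - j"]) (auto simp: algebra_simps)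
  qed
  then obtain a where a: "\<And>k. a' k = d * a k" "\<And>k. 0 \<le> a k" "\<And>k. a k \<le> M"
    by metis
  have \<alpha>: "\<alpha> = radix_value n (\<lambda>k. d * a k)"
    using a'(2) a(1) by presburger
  have abs_a: "\<bar>a k\<bar> \<le> M" for k
    using a(2,3)[of k] by simp
  have "\<alpha> \<in> \<rat>"
  \<comment> \<open>Uniqueness is tested among signed expansions, since differences of points of the
    Cantor set have digits of both signs.\<close>
  proof (cases "\<forall>x. (\<forall>k. \<bar>x k\<bar> \<le> M) \<longrightarrow> radix_value n (\<lambda>k. d * x k) = \<alpha> \<longrightarrow> x = a")
    case False
    then obtain x where x: "\<And>k. \<bar>x k\<bar> \<le> M" "radix_value n (\<lambda>k. d * x k) = \<alpha>" "x \<noteq> a"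
      by blast
    obtain j where j: "a j \<noteq> x j" using x(3) ext[of x a] by metis
    have "radix_value n (\<lambda>k. d * a k) = radix_value n (\<lambda>k. d * x k)"
      using x(2) \<alpha> by simp
    then show ?thesis
      unfolding \<alpha>
      by (rule nonunique_difference_representation_rational[of n d M a x j, OF n d abs_a x(1) _ j])
  next
    case True
    define b where "b k = M - a k" for k
    let ?S = "{radix_value n z |z. \<forall>k. 0 \<le> z k \<and> z k \<le> b k}"
    have NI: "normalized_intersection n D \<alpha> = {of_int d * radix_value n z |z. \<forall>k. 0 \<le> z k \<and> z k \<le> b k}"
      unfolding b_def
      by (rule normalized_intersection_unique[OF n _ D a(2,3) \<alpha>]) (use d(1) True in \<open>simp, blast\<close>)
    obtain \<epsilon> F where \<epsilon>: "\<epsilon> > 0" and F: "\<forall>f\<in>F. \<exists>r b. r > 0 \<and> f = (\<lambda>x. r * x + b)"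
      and ss: "self_similar_set_generated_by F (normalized_intersection n D \<alpha> \<inter> {0..\<epsilon>})"
      using assms(5) by blast
    have b: "0 \<le> b k" "b k \<le> M" "2 * b k \<le> int n - 1" for k
    proof -
      show *: "0 \<le> b k" "b k \<le> M" using a(2,3)[of k] by (auto simp: b_def)
      \<comment> \<open>The uniform gap \<open>d \<ge> 2\<close> is what makes the digits of the
        rescaled set at most half of \<open>n - 1\<close>.\<close>
      have "2 * b k \<le> d * M"
        using * d(1) by (intro mult_mono) auto
      then show "2 * b k \<le> int n - 1" using d(2) by simp
    qed
    have S0: "0 \<le> v" if "v \<in> ?S" for v
    proof -
      from that obtain z where z: "v = radix_value n z" "\<forall>k. 0 \<le> z k \<and> z k \<le> b k" by blast
      show ?thesis unfolding z(1)
      proof (rule radix_nonneg[OF n])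
        fix k show "0 \<le> z k" "z k \<le> M"
          using z(2)[rule_format, of k] b(2)[of k] by linarith+
      qed
    qed
    have "radix_value n (\<lambda>_. 0) = 0" by (simp add: radix_value_def)
    then have "0 \<in> normalized_intersection n D \<alpha>"
      unfolding NI using b(1) by (intro CollectI exI[of _ "\<lambda>_. 0"]) simp
    then have "0 \<in> normalized_intersection n D \<alpha> \<inter> {0..\<epsilon>}"
      using \<epsilon> by simp
    moreover have "0 \<le> x" if "x \<in> normalized_intersection n D \<alpha> \<inter> {0..\<epsilon>}" for x
      using that by simp
    ultimately obtain r where r: "r > 0" "r < 1"
      and rT: "\<And>x. x \<in> normalized_intersection n D \<alpha> \<inter> {0..\<epsilon>} \<Longrightarrow>
                 r * x \<in> normalized_intersection n D \<alpha> \<inter> {0..\<epsilon>}"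
      using self_similar_scaling_factor[OF F ss] by metis
    \<comment> \<open>C(\<alpha>) is \<open>d\<close> times \<open>?S\<close>, so the threshold is
      divided by \<open>d\<close>.\<close>
    have scal: "r * x \<in> ?S" if x: "x \<in> ?S" "x \<le> \<epsilon> / of_int d" for x
    proof -
      have "of_int d * x \<in> normalized_intersection n D \<alpha>"
        using x(1) unfolding NI by blast
      moreover have "of_int d * x \<in> {0..\<epsilon>}"
        using x(2) S0[OF x(1)] d(1) by (simp add: field_simps)
      ultimately have "of_int d * x \<in> normalized_intersection n D \<alpha> \<inter> {0..\<epsilon>}" ..
      from rT[OF this] obtain z where z: "r * (of_int d * x) = of_int d * radix_value n z"
        "\<forall>k. 0 \<le> z k \<and> z k \<le> b k"
        unfolding NI by blast
      then have "r * x = radix_value n z" using d(1) by simp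
      then show ?thesis using z(2) by blast
    qed
    have "\<epsilon> / of_int d > 0" using \<epsilon> d(1) by simp
    from scaling_eventually_periodic[of n b r, OF n b(1,3) r this scal] obtain p N where p: "p > 0" "\<And>k. k \<ge> N \<Longrightarrow> b (k + p) = b k"
      by blast
    have da: "\<bar>d * a k\<bar> \<le> d * M" for k
      using abs_a[of k] d(1) by (simp only: abs_mult) simp
    \<comment> \<open>\<open>a k = M - b k\<close> inherits the eventual period of
      \<open>b\<close>.\<close>
    show ?thesis unfolding \<alpha>
      by (rule radix_eventually_periodic_rational[OF n da p(1), of N]) (use p(2) b_def in simp)
  qed
  \<comment> \<open>The rational number sought is \<alpha> itself.\<close>
  then show ?thesis
    by (auto simp: translation_equivalent_def)
qed

end
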